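(* Let $\ell\in\mathbb{Z}_{>0}$, $d\in\mathbb{Z}_{\geq 0}$, let $\xi_\ell$ be a fixed primitive complex $\ell$-th root of unity, let $S(\ell,d)=\mathbf{C}_\ell\wr S_d$ be the generalized symmetric group and let $A_{(\ell,d)}$ be the algebra of the groupoid $\mathcal{G}_{(\ell,d)}$. Then the map $\Phi:\mathbb{C}[S(\ell,d)]\to A_{(\ell,d)}$, defined multiplicatively on algebra generators by $$\Phi(\sigma)=\sum_{f,g}\sigma_{(f,g)}\ \text{ for }\sigma\in S_d,\qquad \Phi(s_0)=\sum_{f}\xi_\ell^{f(1)}e_f$$ (the second condition being present only if $d\geq 1$; sums run over all objects $f,g$ of $\mathcal{G}_{(\ell,d)}$), is well defined and is an isomorphism of $\mathbb{C}$-algebras.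
   Context: Write $\underline{n}=\{1,\dots,n\}$. $\mathbf{C}_\ell$ is the group of complex $\ell$-th roots of unity with fixed generator $\xi_\ell$. $S(\ell,d)=\mathbf{C}_\ell\wr S_d$ is identified with the group of complex $d\times d$ matrices having exactly one non-zero entry in each row and each column, all non-zero entries lying in $\mathbf{C}_\ell$. The symmetric group $S_d$ is the subgroup of permutation matrices ($\sigma$ sends the basis vector $\epsilon_j$ to $\epsilon_{\sigma(j)}$), and $s_0$ is the diagonal matrix with $(1,1)$-entry $\xi_\ell$ and all other diagonal entries $1$. The group $S(\ell,d)$ is generated by $S_d$ and $s_0$. The groupoid $\mathcal{G}_{(\ell,d)}$: objects are all maps $f:\underline{d}\to\underline{\ell}$; morphisms from $f$ to $g$ are all bijections $\sigma:\underline{d}\to\underline{d}$ with $g\circ\sigma=f$; composition is composition of maps; $e_f$ denotes the identity morphism of $f$. The algebra $A_{(\ell,d)}=\bigoplus_{f,g}\mathbb{C}[\mathcal{G}_{(\ell,d)}(f,g)]$ has all morphisms as a basis, and the product $\tau\sigma$ of two morphisms is their composition if it is defined and $0$ otherwise. For a permutation $\sigma$ and objects $f,g$, $\sigma_{(f,g)}$ denotes $\sigma$ viewed as a morphism from $f$ to $g$ if $g\circ\sigma=f$, and $\sigma_{(f,g)}=0$ otherwise. *)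

theory Defs
  imports
    "HOL-Library.FuncSet"
    "HOL-Library.Poly_Mapping"
    "HOL-Combinatorics.Permutations"
    "HOL-Algebra.Module"
    "Jordan_Normal_Form.Matrix"
begin

section \<open>Complex algebras given by a basis and a product of basis elements\<close>

definition scale :: "complex \<Rightarrow> ('b \<Rightarrow>\<^sub>0 complex) \<Rightarrow> 'b \<Rightarrow>\<^sub>0 complex" where
  "scale c x = Poly_Mapping.map (\<lambda>a. c * a) x"

definition bilinear_ext ::
    "('b \<Rightarrow> 'b \<Rightarrow> 'b \<Rightarrow>\<^sub>0 complex) \<Rightarrow> ('b \<Rightarrow>\<^sub>0 complex) \<Rightarrow> ('b \<Rightarrow>\<^sub>0 complex) \<Rightarrow> 'b \<Rightarrow>\<^sub>0 complex" where
  "bilinear_ext p x y =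
     (\<Sum>a\<in>Poly_Mapping.keys x. \<Sum>b\<in>Poly_Mapping.keys y.
        scale (Poly_Mapping.lookup x a * Poly_Mapping.lookup y b) (p a b))"

definition based_algebra ::
    "'b set \<Rightarrow> ('b \<Rightarrow> 'b \<Rightarrow> 'b \<Rightarrow>\<^sub>0 complex) \<Rightarrow> ('b \<Rightarrow>\<^sub>0 complex) \<Rightarrow> (complex, 'b \<Rightarrow>\<^sub>0 complex) module" where
  "based_algebra B p u =
     \<lparr>carrier = {x. Poly_Mapping.keys x \<subseteq> B},
      mult = bilinear_ext p,
      one = u,
      zero = 0,
      add = (+),
      smult = scale\<rparr>"

text \<open>The locale \<^locale>\<open>algebra\<close> requires the multiplication to be commutative, so it
  does not apply here. Membership in \<^const>\<open>ring_hom\<close> includes preservation of the unit.\<close>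

definition calg_hom :: "(complex, 'a) module \<Rightarrow> (complex, 'b) module \<Rightarrow> ('a \<Rightarrow> 'b) set" where
  "calg_hom A B =
     {h \<in> ring_hom A B. \<forall>c. \<forall>x\<in>carrier A. h (c \<odot>\<^bsub>A\<^esub> x) = c \<odot>\<^bsub>B\<^esub> h x}"

definition calg_iso :: "(complex, 'a) module \<Rightarrow> (complex, 'b) module \<Rightarrow> ('a \<Rightarrow> 'b) set" where
  "calg_iso A B = {h \<in> calg_hom A B. bij_betw h (carrier A) (carrier B)}"

definition group_algebra :: "('g, 'm) monoid_scheme \<Rightarrow> (complex, 'g \<Rightarrow>\<^sub>0 complex) module" where
  "group_algebra G =
     based_algebra (carrier G)
       (\<lambda>g h. Poly_Mapping.single (g \<otimes>\<^bsub>G\<^esub> h) 1)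
       (Poly_Mapping.single \<one>\<^bsub>G\<^esub> 1)"


section \<open>The generalized symmetric group\<close>

definition primitive_root_of_unity :: "nat \<Rightarrow> complex \<Rightarrow> bool" where
  "primitive_root_of_unity l \<xi> \<longleftrightarrow> \<xi> ^ l = 1 \<and> (\<forall>k. 0 < k \<and> k < l \<longrightarrow> \<xi> ^ k \<noteq> 1)"

text \<open>Matrix entries are indexed from \<open>0\<close>, whereas permutations act on \<open>{1..d}\<close>:
  row (column) index \<open>i\<close> stands for the element \<open>Suc i\<close>.\<close>

definition gen_sym_group :: "nat \<Rightarrow> nat \<Rightarrow> complex mat monoid" where
  "gen_sym_group l d =
     \<lparr>carrier = {M \<in> carrier_mat d d.
        (\<forall>i<d. \<exists>!j. j < d \<and> M $$ (i, j) \<noteq> 0) \<and>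
        (\<forall>j<d. \<exists>!i. i < d \<and> M $$ (i, j) \<noteq> 0) \<and>
        (\<forall>i<d. \<forall>j<d. M $$ (i, j) \<noteq> 0 \<longrightarrow> M $$ (i, j) ^ l = 1)},
      mult = (*),
      one = 1\<^sub>m d\<rparr>"

definition perm_matrix :: "nat \<Rightarrow> (nat \<Rightarrow> nat) \<Rightarrow> complex mat" where
  "perm_matrix d \<sigma> = mat d d (\<lambda>(i, j). if Suc i = \<sigma> (Suc j) then 1 else 0)"

definition s0_matrix :: "nat \<Rightarrow> complex \<Rightarrow> complex mat" where
  "s0_matrix d \<xi> = mat_diag d (\<lambda>i. if i = 0 then \<xi> else 1)"


section \<open>The groupoid and its algebra\<close>

text \<open>Objects are extensional functions. A bijection of \<open>{1..d}\<close> is represented by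
  a function that is the identity outside \<open>{1..d}\<close>, so that \<open>g \<circ> \<sigma> = f\<close> may be
  stated as an equation between total functions.\<close>

definition objs :: "nat \<Rightarrow> nat \<Rightarrow> (nat \<Rightarrow> nat) set" where
  "objs l d = {1..d} \<rightarrow>\<^sub>E {1..l}"

datatype morphism = Mor (src: "nat \<Rightarrow> nat") (bij_of: "nat \<Rightarrow> nat") (tgt: "nat \<Rightarrow> nat")

definition mors :: "nat \<Rightarrow> nat \<Rightarrow> morphism set" where
  "mors l d =
     {Mor f \<sigma> g | f \<sigma> g. f \<in> objs l d \<and> g \<in> objs l d \<and> \<sigma> permutes {1..d} \<and> g \<circ> \<sigma> = f}"

definition mor_prod :: "morphism \<Rightarrow> morphism \<Rightarrow> morphism \<Rightarrow>\<^sub>0 complex" where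
  "mor_prod \<tau> \<sigma> =
     (if src \<tau> = tgt \<sigma>
      then Poly_Mapping.single (Mor (src \<sigma>) (bij_of \<tau> \<circ> bij_of \<sigma>) (tgt \<tau>)) 1
      else 0)"

definition id_mor :: "(nat \<Rightarrow> nat) \<Rightarrow> morphism \<Rightarrow>\<^sub>0 complex" where
  "id_mor f = Poly_Mapping.single (Mor f id f) 1"

definition perm_mor :: "(nat \<Rightarrow> nat) \<Rightarrow> (nat \<Rightarrow> nat) \<Rightarrow> (nat \<Rightarrow> nat) \<Rightarrow> morphism \<Rightarrow>\<^sub>0 complex" where
  "perm_mor \<sigma> f g = (if g \<circ> \<sigma> = f then Poly_Mapping.single (Mor f \<sigma> g) 1 else 0)"

definition groupoid_algebra :: "nat \<Rightarrow> nat \<Rightarrow> (complex, morphism \<Rightarrow>\<^sub>0 complex) module" where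
  "groupoid_algebra l d =
     based_algebra (mors l d) mor_prod (\<Sum>f\<in>objs l d. id_mor f)"


section \<open>The prescribed values on generators\<close>

definition generator_values ::
    "nat \<Rightarrow> nat \<Rightarrow> complex \<Rightarrow> ((complex mat \<Rightarrow>\<^sub>0 complex) \<Rightarrow> morphism \<Rightarrow>\<^sub>0 complex) \<Rightarrow> bool" where
  "generator_values l d \<xi> \<Phi> \<longleftrightarrow>
     (\<forall>\<sigma>. \<sigma> permutes {1..d} \<longrightarrow>
        \<Phi> (Poly_Mapping.single (perm_matrix d \<sigma>) 1) =
          (\<Sum>f\<in>objs l d. \<Sum>g\<in>objs l d. perm_mor \<sigma> f g)) \<and>
     (d \<ge> 1 \<longrightarrow>
        \<Phi> (Poly_Mapping.single (s0_matrix d \<xi>) 1) =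
          (\<Sum>f\<in>objs l d. scale (\<xi> ^ f 1) (id_mor f)))"

end

theory Submission
  imports Defs
begin

text \<open>Every element of \<open>S(l, d)\<close> is the matrix of a permutation \<open>\<sigma>\<close> with entries
  \<open>\<xi> ^ k j\<close> for some \<open>k : {1..d} \<rightarrow> {1..l}\<close>, and the prescribed values force its image to be the sum
  over all objects \<open>f\<close> of \<open>\<xi> ^ (\<Sum>j. k j * f j)\<close> times the morphism \<open>\<sigma>\<close> with source \<open>f\<close>. So for
  each \<open>\<sigma>\<close> the map is the Fourier transform of the group \<open>(\<int>/l)^d\<close>, which is inverted by the
  orthogonality of characters.\<close>

section \<open>Linear extension\<close>

lemma lookup_scale [simp]: "Poly_Mapping.lookup (scale c x) b = c * Poly_Mapping.lookup x b"
  by (simp add: scale_def Poly_Mapping.map.rep_eq when_def)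

interpretation scale: vector_space scale
  by unfold_locales (auto intro!: poly_mapping_eqI simp: lookup_add algebra_simps)

lemma scale_single [simp]: "scale c (Poly_Mapping.single a e) = Poly_Mapping.single a (c * e)"
  by (rule poly_mapping_eqI) (simp add: lookup_single when_def)

lemma keys_scale: "Poly_Mapping.keys (scale c x) \<subseteq> Poly_Mapping.keys x"
  by (auto simp: in_keys_iff)

text \<open>Defined on all finitely supported functions, so that linearity holds without carrier
  conditions; a chosen basis enters only through conditions on supports.\<close>

definition linext :: "('a \<Rightarrow> 'b \<Rightarrow>\<^sub>0 complex) \<Rightarrow> ('a \<Rightarrow>\<^sub>0 complex) \<Rightarrow> 'b \<Rightarrow>\<^sub>0 complex" where
  "linext \<phi> x = (\<Sum>a\<in>Poly_Mapping.keys x. scale (Poly_Mapping.lookup x a) (\<phi> a))"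

text \<open>Coefficients outside the support are zero, so vectors with different supports can be
  summed over one common finite set.\<close>

lemma linext_superset:
  assumes "finite S" "Poly_Mapping.keys x \<subseteq> S"
  shows "linext \<phi> x = (\<Sum>a\<in>S. scale (Poly_Mapping.lookup x a) (\<phi> a))"
  unfolding linext_def using assms by (intro sum.mono_neutral_left) (auto simp: in_keys_iff)

lemma linext_add: "linext \<phi> (x + y) = linext \<phi> x + linext \<phi> y"
proof -
  let ?S = "Poly_Mapping.keys x \<union> Poly_Mapping.keys y"
  have *: "linext \<phi> z = (\<Sum>a\<in>?S. scale (Poly_Mapping.lookup z a) (\<phi> a))"
    if "Poly_Mapping.keys z \<subseteq> ?S" for z
    using that by (intro linext_superset) auto
  show ?thesis
    using keys_add[of x y]
    by (simp add: * lookup_add scale.scale_left_distrib sum.distrib)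
qed

lemma linext_scale: "linext \<phi> (scale c x) = scale c (linext \<phi> x)"
proof -
  have "linext \<phi> (scale c x) =
      (\<Sum>a\<in>Poly_Mapping.keys x. scale (Poly_Mapping.lookup (scale c x) a) (\<phi> a))"
    by (intro linext_superset keys_scale) simp
  then show ?thesis by (simp add: linext_def scale.scale_sum_right)
qed

lemma linext_single [simp]: "linext \<phi> (Poly_Mapping.single a c) = scale c (\<phi> a)"
  by (simp add: linext_def)

lemma linext_zero [simp]: "linext \<phi> 0 = 0"
  by (simp add: linext_def)

lemma linext_sum: "linext \<phi> (sum h S) = (\<Sum>i\<in>S. linext \<phi> (h i))"
  by (induction S rule: infinite_finite_induct) (simp_all add: linext_add)

lemma linext_cong:
  "(\<And>a. a \<in> Poly_Mapping.keys x \<Longrightarrow> \<phi> a = \<psi> a) \<Longrightarrow> linext \<phi> x = linext \<psi> x"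
  by (simp add: linext_def)

lemma linext_linext: "linext \<psi> (linext \<phi> x) = linext (\<lambda>a. linext \<psi> (\<phi> a)) x"
  unfolding linext_def[of \<phi> x] linext_sum linext_scale by (simp add: linext_def[of _ x])

lemma linext_swap:
  "linext (\<lambda>a. linext (\<lambda>b. h a b) y) x = linext (\<lambda>b. linext (\<lambda>a. h a b) x) y"
  unfolding linext_def scale.scale_sum_right
  by (subst sum.swap) (simp add: mult.commute)

lemma linext_unit [simp]: "linext (\<lambda>a. Poly_Mapping.single a 1) x = x"
  by (rule poly_mapping_eqI) (auto simp: linext_def lookup_sum lookup_single when_def in_keys_iff)

lemma keys_linext:
  assumes "\<And>a. a \<in> Poly_Mapping.keys x \<Longrightarrow> Poly_Mapping.keys (\<phi> a) \<subseteq> B"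
  shows "Poly_Mapping.keys (linext \<phi> x) \<subseteq> B"
  unfolding linext_def
  by (rule order.trans[OF keys_sum]) (intro UN_least order.trans[OF keys_scale] assms)

lemma bilinear_ext_linext: "bilinear_ext p x y = linext (\<lambda>a. linext (p a) y) x"
  by (simp add: bilinear_ext_def linext_def scale.scale_sum_right)

lemma bilinear_ext_single [simp]:
  "bilinear_ext p (Poly_Mapping.single a c) (Poly_Mapping.single b e) = scale (c * e) (p a b)"
  by (simp add: bilinear_ext_linext)

lemma bilinear_ext_sum_single:
  "bilinear_ext p (\<Sum>a\<in>S. Poly_Mapping.single (u a) (c a)) (\<Sum>b\<in>T. Poly_Mapping.single (v b) (e b)) =
   (\<Sum>a\<in>S. \<Sum>b\<in>T. scale (c a * e b) (p (u a) (v b)))"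
  by (simp add: bilinear_ext_linext linext_sum scale.scale_sum_right)

text \<open>Bilinearity expresses the product of two images through the products of images of basis
  elements; this is what reduces multiplicativity of \<open>linext \<phi>\<close> to pairs of basis
  elements.\<close>

lemma bilinear_ext_linext_linext:
  "bilinear_ext q (linext \<phi> x) (linext \<phi> y) =
   linext (\<lambda>a. linext (\<lambda>b. bilinear_ext q (\<phi> a) (\<phi> b)) y) x"
proof -
  have "bilinear_ext q u (linext \<phi> y) = linext (\<lambda>b. bilinear_ext q u (\<phi> b)) y" for u
    by (simp add: bilinear_ext_linext linext_linext linext_swap[of _ y u])
  moreover have "bilinear_ext q (linext \<phi> x) v = linext (\<lambda>a. bilinear_ext q (\<phi> a) v) x" for v
    by (simp add: bilinear_ext_linext linext_linext)
  ultimately show ?thesis by (simp add: linext_swap[of _ x y])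
qed

section \<open>Homomorphisms of based algebras\<close>

lemma carrier_based_algebra: "carrier (based_algebra B p u) = {x. Poly_Mapping.keys x \<subseteq> B}"
  unfolding based_algebra_def partial_object.simps ..

lemma calg_hom_based_algebra_iff:
  "h \<in> calg_hom (based_algebra A p u) (based_algebra B q v) \<longleftrightarrow>
     (\<forall>x. Poly_Mapping.keys x \<subseteq> A \<longrightarrow> Poly_Mapping.keys (h x) \<subseteq> B) \<and>
     (\<forall>x y. Poly_Mapping.keys x \<subseteq> A \<and> Poly_Mapping.keys y \<subseteq> A \<longrightarrow>
        h (bilinear_ext p x y) = bilinear_ext q (h x) (h y) \<and> h (x + y) = h x + h y) \<and>
     h u = v \<and>
     (\<forall>c x. Poly_Mapping.keys x \<subseteq> A \<longrightarrow> h (scale c x) = scale c (h x))"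
  unfolding calg_hom_def ring_hom_def based_algebra_def Pi_def Ball_def
    module.simps ring.simps partial_object.simps monoid.simps mem_Collect_eq
  by blast

text \<open>The image of a product and the product of the images are both double linear extensions,
  so they agree once they agree on pairs of basis elements.\<close>

lemma linext_calg_hom:
  assumes keys: "\<And>a. a \<in> A \<Longrightarrow> Poly_Mapping.keys (\<phi> a) \<subseteq> B"
    and mult: "\<And>a b. a \<in> A \<Longrightarrow> b \<in> A \<Longrightarrow> linext \<phi> (p a b) = bilinear_ext q (\<phi> a) (\<phi> b)"
    and unit: "linext \<phi> u = v"
  shows "linext \<phi> \<in> calg_hom (based_algebra A p u) (based_algebra B q v)"
proof -
  have "linext \<phi> (bilinear_ext p x y) = bilinear_ext q (linext \<phi> x) (linext \<phi> y)"
    if "Poly_Mapping.keys x \<subseteq> A" "Poly_Mapping.keys y \<subseteq> A" for x y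
    unfolding bilinear_ext_linext_linext bilinear_ext_linext[of p] linext_linext
    using that mult by (intro linext_cong) auto
  moreover have "Poly_Mapping.keys (linext \<phi> x) \<subseteq> B" if "Poly_Mapping.keys x \<subseteq> A" for x
    using that keys by (intro keys_linext) auto
  ultimately show ?thesis
    by (simp add: calg_hom_based_algebra_iff linext_add linext_scale unit)
qed

text \<open>The inverse is taken to be a linear extension too, so both composites are linear and can
  be compared with the identity on basis elements.\<close>

lemma linext_calg_iso:
  assumes hom: "linext \<phi> \<in> calg_hom (based_algebra A p u) (based_algebra B q v)"
    and keys: "\<And>b. b \<in> B \<Longrightarrow> Poly_Mapping.keys (\<psi> b) \<subseteq> A"
    and inv1: "\<And>a. a \<in> A \<Longrightarrow> linext \<psi> (\<phi> a) = Poly_Mapping.single a 1"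
    and inv2: "\<And>b. b \<in> B \<Longrightarrow> linext \<phi> (\<psi> b) = Poly_Mapping.single b 1"
  shows "linext \<phi> \<in> calg_iso (based_algebra A p u) (based_algebra B q v)"
proof -
  have 1: "linext \<psi> (linext \<phi> x) = x" if "Poly_Mapping.keys x \<subseteq> A" for x
  proof -
    have "linext \<psi> (linext \<phi> x) = linext (\<lambda>a. Poly_Mapping.single a 1) x"
      unfolding linext_linext using that inv1 by (intro linext_cong) auto
    then show ?thesis by simp
  qed
  have 2: "linext \<phi> (linext \<psi> x) = x" if "Poly_Mapping.keys x \<subseteq> B" for x
  proof -
    have "linext \<phi> (linext \<psi> x) = linext (\<lambda>a. Poly_Mapping.single a 1) x"
      unfolding linext_linext using that inv2 by (intro linext_cong) auto
    then show ?thesis by simp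
  qed
  have "bij_betw (linext \<phi>) {x. Poly_Mapping.keys x \<subseteq> A} {x. Poly_Mapping.keys x \<subseteq> B}"
  proof (rule bij_betw_byWitness[where f' = "linext \<psi>"])
    show "linext \<phi> ` {x. Poly_Mapping.keys x \<subseteq> A} \<subseteq> {x. Poly_Mapping.keys x \<subseteq> B}"
      using hom by (simp add: calg_hom_based_algebra_iff image_subset_iff)
    show "linext \<psi> ` {x. Poly_Mapping.keys x \<subseteq> B} \<subseteq> {x. Poly_Mapping.keys x \<subseteq> A}"
      by (intro image_subsetI CollectI keys_linext keys) auto
  qed (use 1 2 in auto)
  with hom show ?thesis by (simp add: calg_iso_def carrier_based_algebra)
qed

lemma calg_hom_eq_linext:
  assumes \<Psi>: "\<Psi> \<in> calg_hom (based_algebra A p u) (based_algebra B q v)"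
    and x: "Poly_Mapping.keys x \<subseteq> A"
  shows "\<Psi> x = linext (\<lambda>a. \<Psi> (Poly_Mapping.single a 1)) x"
proof -
  have scl: "\<Psi> (scale c y) = scale c (\<Psi> y)" if "Poly_Mapping.keys y \<subseteq> A" for c y
    using \<Psi> that by (simp add: calg_hom_based_algebra_iff)
  have add: "\<Psi> (y + z) = \<Psi> y + \<Psi> z" if "Poly_Mapping.keys y \<subseteq> A" "Poly_Mapping.keys z \<subseteq> A" for y z
    using \<Psi> that by (simp add: calg_hom_based_algebra_iff)
  \<comment> \<open>\<open>\<Psi>\<close> is known to be additive only on vectors supported in
    \<open>A\<close>, so the induction carries the support of the partial sum along.\<close>
  have "\<Psi> (\<Sum>a\<in>S. Poly_Mapping.single a (c a)) = (\<Sum>a\<in>S. scale (c a) (\<Psi> (Poly_Mapping.single a 1)))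
      \<and> Poly_Mapping.keys (\<Sum>a\<in>S. Poly_Mapping.single a (c a)) \<subseteq> A"
    if "finite S" "S \<subseteq> A" for S and c :: "'a \<Rightarrow> complex"
    using that
  proof (induction S)
    case empty
    \<comment> \<open>\<open>\<Psi> 0 = 0\<close> comes from homogeneity with the scalar 0.\<close>
    show ?case using scl[of 0 0] by simp
  next
    case (insert a S)
    have k: "Poly_Mapping.keys (Poly_Mapping.single a (c a)) \<subseteq> A"
      using insert.prems by auto
    have "\<Psi> (Poly_Mapping.single a (c a)) = scale (c a) (\<Psi> (Poly_Mapping.single a 1))"
      using scl[of "Poly_Mapping.single a 1" "c a"] insert.prems by simp
    then show ?case
      using insert k add[OF k] keys_add[of "Poly_Mapping.single a (c a)" "\<Sum>a\<in>S. Poly_Mapping.single a (c a)"]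
      by auto
  qed
  from this[of "Poly_Mapping.keys x" "Poly_Mapping.lookup x"] x
  have "\<Psi> (\<Sum>a\<in>Poly_Mapping.keys x. Poly_Mapping.single a (Poly_Mapping.lookup x a)) =
      (\<Sum>a\<in>Poly_Mapping.keys x. scale (Poly_Mapping.lookup x a) (\<Psi> (Poly_Mapping.single a 1)))"
    by simp
  moreover have "(\<Sum>a\<in>Poly_Mapping.keys x. Poly_Mapping.single a (Poly_Mapping.lookup x a)) = x"
    by (rule linext_unit[of x, unfolded linext_def scale_single mult_1_right])
  ultimately show ?thesis
    by (simp add: linext_def)
qed

section \<open>Characters of a power of a cyclic group\<close>

text \<open>Equal powers with different exponents would, after division, give a power equal to 1
  whose exponent lies strictly between 0 and \<open>l\<close>.\<close>

lemma primitive_root_power_inj: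
  assumes "primitive_root_of_unity l \<xi>" "a \<in> {1..l}" "b \<in> {1..l}" "\<xi> ^ a = \<xi> ^ b"
  shows "a = b"
proof -
  have nz: "\<xi> \<noteq> 0"
    using assms by (auto simp: primitive_root_of_unity_def power_0_left split: if_splits)
  have "False" if "a < b" "a \<in> {1..l}" "b \<in> {1..l}" "\<xi> ^ a = \<xi> ^ b" for a b
  proof -
    have "\<xi> ^ a * \<xi> ^ (b - a) = \<xi> ^ (a + (b - a))"
      by (simp only: power_add)
    also have "\<dots> = \<xi> ^ a * 1"
      using that by simp
    finally have "\<xi> ^ a * \<xi> ^ (b - a) = \<xi> ^ a * 1" .
    then have "\<xi> ^ (b - a) = 1" using nz by simp
    moreover have "0 < b - a" "b - a < l" using that by auto
    ultimately show False using assms(1) by (auto simp: primitive_root_of_unity_def)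
  qed
  from this[of a b] this[of b a] assms show ?thesis by (metis linorder_neqE_nat)
qed

text \<open>A counting argument: \<open>z ^ l = 1\<close> has exactly \<open>l\<close> complex
  solutions, and the \<open>l\<close> powers of \<open>\<xi>\<close> are distinct solutions.
  Exponents run from 1 to \<open>l\<close> to match the values of objects.\<close>

lemma root_of_unity_eq_power:
  assumes "l > 0" "primitive_root_of_unity l \<xi>" "z ^ l = 1"
  shows "\<exists>k\<in>{1..l}. z = \<xi> ^ k"
proof -
  have "inj_on (\<lambda>k. \<xi> ^ k) {1..l}"
    using primitive_root_power_inj[OF assms(2)] by (auto intro: inj_onI)
  then have "card ((\<lambda>k. \<xi> ^ k) ` {1..l}) = card {z::complex. z ^ l = 1}"
    using card_roots_unity_eq[of l] assms(1) by (simp add: card_image)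
  moreover have "(\<lambda>k. \<xi> ^ k) ` {1..l} \<subseteq> {z. z ^ l = 1}"
    using assms(2)
    by (auto simp: primitive_root_of_unity_def) (metis mult.commute power_mult power_one)
  moreover have "finite {z::complex. z ^ l = 1}"
    using assms(1) finite_roots_unity by auto
  ultimately have "(\<lambda>k. \<xi> ^ k) ` {1..l} = {z. z ^ l = 1}"
    by (metis card_subset_eq)
  with assms(3) show ?thesis by auto
qed

text \<open>When \<open>\<xi> ^ l = 1\<close>, this is the symmetric pairing of (Z/l)^d with itself,
  residues being represented by 1 to \<open>l\<close>. The product form lets sums over
  \<open>objs\<close> factor by coordinates.\<close>

definition character :: "nat \<Rightarrow> complex \<Rightarrow> (nat \<Rightarrow> nat) \<Rightarrow> (nat \<Rightarrow> nat) \<Rightarrow> complex" where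
  "character d \<xi> k f = (\<Prod>j\<in>{1..d}. \<xi> ^ (k j * f j))"

lemma character_commute: "character d \<xi> k f = character d \<xi> f k"
  by (simp add: character_def mult.commute)

lemma finite_objs [simp]: "finite (objs l d)"
  by (simp add: objs_def finite_PiE)

text \<open>Division takes the place of complex conjugation. The sum factors into one geometric sum
  per coordinate, and a coordinate where \<open>f\<close> and \<open>f'\<close> differ contributes
  the factor 0.\<close>

lemma character_orthogonality:
  assumes "l > 0" "primitive_root_of_unity l \<xi>" "f \<in> objs l d" "f' \<in> objs l d"
  shows "(\<Sum>k\<in>objs l d. character d \<xi> k f / character d \<xi> k f') = (if f = f' then of_nat l ^ d else 0)"
proof -
  have nz: "\<xi> \<noteq> 0" and one: "\<xi> ^ l = 1"
    using assms(1,2) by (auto simp: primitive_root_of_unity_def power_0_left split: if_splits)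
  define r where "r j = \<xi> ^ f j / \<xi> ^ f' j" for j
  have r1: "r j = 1 \<longleftrightarrow> f j = f' j" if "j \<in> {1..d}" for j
  proof -
    have mem: "f j \<in> {1..l}" "f' j \<in> {1..l}"
      using assms(3,4) that unfolding objs_def by (blast dest: PiE_mem)+
    have "r j = 1 \<longleftrightarrow> \<xi> ^ f j = \<xi> ^ f' j"
      using nz by (simp add: r_def)
    then show ?thesis
      using primitive_root_power_inj[OF assms(2) mem] by metis
  qed
  have "(\<xi> ^ n) ^ l = 1" for n
    using one by (metis mult.commute power_mult power_one)
  then have rl: "r j ^ l = 1" for j
    by (simp add: r_def power_divide)
  \<comment> \<open>For \<open>r j \<noteq> 1\<close> the closed form has numerator
    \<open>r j - r j ^ (l + 1)\<close>, which vanishes because \<open>r j ^ l = 1\<close>.\<close>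
  have geo: "(\<Sum>k\<in>{1..l}. r j ^ k) = (if r j = 1 then of_nat l else 0)" for j
    using rl[of j] by (simp add: sum_gp)
  have "(\<Sum>k\<in>objs l d. character d \<xi> k f / character d \<xi> k f') =
      (\<Sum>k\<in>objs l d. \<Prod>j\<in>{1..d}. r j ^ k j)"
    by (simp add: character_def r_def power_divide mult.commute
        flip: prod_dividef power_mult)
  also have "\<dots> = (\<Prod>j\<in>{1..d}. \<Sum>k\<in>{1..l}. r j ^ k)"
    unfolding objs_def by (rule prod_sum_PiE[symmetric]) auto
  also have "\<dots> = (\<Prod>j\<in>{1..d}. if f j = f' j then of_nat l else 0)"
    by (intro prod.cong refl) (simp only: geo r1)
  also have "\<dots> = (if f = f' then of_nat l ^ d else 0)"
  proof (cases "f = f'")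
    case False
    then obtain j where "j \<in> {1..d}" "f j \<noteq> f' j"
      using assms(3,4) unfolding objs_def by (metis PiE_ext)
    then have "(\<Prod>j\<in>{1..d}. if f j = f' j then of_nat l else (0::complex)) = 0"
      by (intro prod_zero) auto
    with False show ?thesis by simp
  qed simp
  finally show ?thesis .
qed

section \<open>Monomial matrices\<close>

abbreviation perm_inv :: "(nat \<Rightarrow> nat) \<Rightarrow> nat \<Rightarrow> nat" where
  "perm_inv \<equiv> Hilbert_Choice.inv"

text \<open>Coefficients are indexed by columns: the matrix sends the basis vector at
  \<open>j\<close> to \<open>a j\<close> times the basis vector at \<open>\<sigma> j\<close>. Hence
  the shift by \<open>\<tau>\<close> in the left coefficients of a product.\<close>

definition monomial_mat :: "nat \<Rightarrow> (nat \<Rightarrow> nat) \<Rightarrow> (nat \<Rightarrow> complex) \<Rightarrow> complex mat" where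
  "monomial_mat d \<sigma> a = mat d d (\<lambda>(i, j). if Suc i = \<sigma> (Suc j) then a (Suc j) else 0)"

lemma monomial_mat_cong:
  "(\<And>j. j \<in> {1..d} \<Longrightarrow> a j = b j) \<Longrightarrow> monomial_mat d \<sigma> a = monomial_mat d \<sigma> b"
  by (auto simp: monomial_mat_def)

lemma perm_matrix_eq: "perm_matrix d \<sigma> = monomial_mat d \<sigma> (\<lambda>_. 1)"
  by (simp add: perm_matrix_def monomial_mat_def)

lemma s0_matrix_eq: "s0_matrix d \<xi> = monomial_mat d id (\<lambda>j. if j = 1 then \<xi> else 1)"
  by (auto simp: s0_matrix_def mat_diag_def monomial_mat_def)

lemma one_mat_eq: "1\<^sub>m d = monomial_mat d id (\<lambda>_. 1)"
  by (auto simp: monomial_mat_def)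

lemma permutes_Suc_obtain:
  assumes "\<sigma> permutes {1..d}" "j < d"
  obtains i where "i < d" "\<sigma> (Suc j) = Suc i"
proof -
  have "\<sigma> (Suc j) \<in> {1..d}"
    using permutes_in_image[OF assms(1)] assms(2) by auto
  then show thesis using that[of "\<sigma> (Suc j) - 1"] by auto
qed

lemma monomial_mat_mult:
  assumes "\<sigma> permutes {1..d}" "\<tau> permutes {1..d}"
  shows "monomial_mat d \<sigma> a * monomial_mat d \<tau> b = monomial_mat d (\<sigma> \<circ> \<tau>) (\<lambda>j. a (\<tau> j) * b j)"
proof (rule eq_matI)
  fix i j
  assume "i < dim_row (monomial_mat d (\<sigma> \<circ> \<tau>) (\<lambda>j. a (\<tau> j) * b j))"
    "j < dim_col (monomial_mat d (\<sigma> \<circ> \<tau>) (\<lambda>j. a (\<tau> j) * b j))"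
  then have ij: "i < d" "j < d" by (simp_all add: monomial_mat_def)
  \<comment> \<open>Column \<open>j\<close> of the right factor can be non-zero only in row
    \<open>m\<close>, so the matrix product keeps a single term.\<close>
  obtain m where m: "m < d" "\<tau> (Suc j) = Suc m"
    using permutes_Suc_obtain[OF assms(2) ij(2)] .
  have "(monomial_mat d \<sigma> a * monomial_mat d \<tau> b) $$ (i, j) =
      (\<Sum>k = 0..<d. (if Suc i = \<sigma> (Suc k) then a (Suc k) else 0) * (if k = m then b (Suc j) else 0))"
    using ij m by (simp add: monomial_mat_def scalar_prod_def)
  also have "\<dots> = (\<Sum>k = 0..<d. if k = m then (if Suc i = \<sigma> (Suc k) then a (Suc k) * b (Suc j) else 0) else 0)"
    by (intro sum.cong) auto
  also have "\<dots> = monomial_mat d (\<sigma> \<circ> \<tau>) (\<lambda>j. a (\<tau> j) * b j) $$ (i, j)"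
    using ij m by (simp add: monomial_mat_def)
  finally show "(monomial_mat d \<sigma> a * monomial_mat d \<tau> b) $$ (i, j) =
    monomial_mat d (\<sigma> \<circ> \<tau>) (\<lambda>j. a (\<tau> j) * b j) $$ (i, j)" .
qed (simp_all add: monomial_mat_def)

lemma monomial_mat_in_gen_sym_group:
  assumes "l > 0" "\<sigma> permutes {1..d}" "\<And>j. j \<in> {1..d} \<Longrightarrow> a j ^ l = 1"
  shows "monomial_mat d \<sigma> a \<in> carrier (gen_sym_group l d)"
proof -
  \<comment> \<open>Since \<open>l > 0\<close>, the number 0 is not an \<open>l\<close>-th root of
    unity.\<close>
  have nz: "a (Suc j) \<noteq> 0" if "j < d" for j
    using assms(1) assms(3)[of "Suc j"] that by (auto simp: power_0_left)
  have inv: "perm_inv \<sigma> permutes {1..d}"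
    by (rule permutes_inv[OF assms(2)])
  have row: "\<exists>!j. j < d \<and> Suc i = \<sigma> (Suc j)" if i: "i < d" for i
  proof -
    obtain j where j: "j < d" "perm_inv \<sigma> (Suc i) = Suc j"
      using permutes_Suc_obtain[OF inv i] .
    then have "Suc i = \<sigma> (Suc j)"
      using permutes_inverses(1)[OF assms(2)] by metis
    moreover have "j' = j" if "Suc i = \<sigma> (Suc j')" for j'
      using permutes_inverses(2)[OF assms(2)] that j(2) by (metis Suc_inject)
    ultimately show ?thesis using j(1) by blast
  qed
  have col: "\<exists>!i. i < d \<and> Suc i = \<sigma> (Suc j)" if j: "j < d" for j
    using permutes_Suc_obtain[OF assms(2) j] by (metis Suc_inject)
  have entry: "monomial_mat d \<sigma> a $$ (i, j) \<noteq> 0 \<longleftrightarrow> Suc i = \<sigma> (Suc j)" if "i < d" "j < d" for i j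
    using that nz by (simp add: monomial_mat_def)
  have "\<exists>!j. j < d \<and> monomial_mat d \<sigma> a $$ (i, j) \<noteq> 0" if "i < d" for i
    using row[OF that] entry[OF that] by metis
  moreover have "\<exists>!i. i < d \<and> monomial_mat d \<sigma> a $$ (i, j) \<noteq> 0" if "j < d" for j
    using col[OF that] entry[OF _ that] by metis
  moreover have "monomial_mat d \<sigma> a $$ (i, j) ^ l = 1"
    if "i < d" "j < d" "monomial_mat d \<sigma> a $$ (i, j) \<noteq> 0" for i j
    using that assms(3) by (auto simp: monomial_mat_def split: if_splits)
  ultimately show ?thesis
    unfolding gen_sym_group_def partial_object.simps
    by (simp add: monomial_mat_def)
qed

text \<open>The positions of the non-zero entries give \<open>\<sigma>\<close>, and their values,
  being \<open>l\<close>-th roots of unity, give the exponents \<open>k\<close>. Exponents are taken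
  from \<open>objs\<close>, so both sides of the Fourier transform share one index set.\<close>

lemma gen_sym_group_obtain_monomial:
  assumes l: "l > 0" "primitive_root_of_unity l \<xi>" and M: "M \<in> carrier (gen_sym_group l d)"
  obtains \<sigma> k where "\<sigma> permutes {1..d}" "k \<in> objs l d" "M = monomial_mat d \<sigma> (\<lambda>j. \<xi> ^ k j)"
proof -
  note M' = M[unfolded gen_sym_group_def partial_object.simps mem_Collect_eq]
  note dim = M'[THEN conjunct1]
    and row = M'[THEN conjunct2, THEN conjunct1, rule_format]
    and col = M'[THEN conjunct2, THEN conjunct2, THEN conjunct1, rule_format]
    and root = M'[THEN conjunct2, THEN conjunct2, THEN conjunct2, rule_format]
  \<comment> \<open>The row of the unique non-zero entry in column \<open>j\<close>, both counted
    from 0; \<open>\<sigma>\<close> below is \<open>r\<close> shifted to indices from 1.\<close>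
  define r where "r j = (THE i. i < d \<and> M $$ (i, j) \<noteq> 0)" for j
  have r: "r j < d" "M $$ (r j, j) \<noteq> 0" if "j < d" for j
    using theI'[OF col[OF that]] by (simp_all add: r_def)
  have r_eq: "M $$ (i, j) \<noteq> 0 \<longleftrightarrow> i = r j" if "i < d" "j < d" for i j
    using col[OF that(2)] r[OF that(2)] that(1) by metis
  define \<sigma> where "\<sigma> j = (if j \<in> {1..d} then Suc (r (j - 1)) else j)" for j
  \<comment> \<open>Two columns cannot share a row, as each row has only one non-zero entry;
    surjectivity then follows by finiteness.\<close>
  have inj: "inj_on \<sigma> {1..d}"
  proof (rule inj_onI)
    fix i j assume ij: "i \<in> {1..d}" "j \<in> {1..d}" "\<sigma> i = \<sigma> j"
    then have *: "i - 1 < d" "j - 1 < d" "r (i - 1) = r (j - 1)"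
      by (auto simp: \<sigma>_def)
    then have "i - 1 = j - 1"
      using row[OF r(1)[OF *(1)]] r(2)[OF *(1)] r(2)[OF *(2)] by metis
    then show "i = j" using ij(1,2) unfolding atLeastAtMost_iff by arith
  qed
  have sub: "\<sigma> ` {1..d} \<subseteq> {1..d}"
  proof (rule image_subsetI)
    fix j assume j: "j \<in> {1..d}"
    then have "j - 1 < d" by auto
    from r(1)[OF this] show "\<sigma> j \<in> {1..d}" using j by (simp add: \<sigma>_def)
  qed
  have perm: "\<sigma> permutes {1..d}"
  proof (rule bij_imp_permutes)
    show "bij_betw \<sigma> {1..d} {1..d}"
      using inj sub by (simp add: bij_betw_def endo_inj_surj)
    show "\<sigma> x = x" if "x \<notin> {1..d}" for x
      unfolding \<sigma>_def using that by (rule if_not_P)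
  qed
  \<comment> \<open>The restricted abstraction makes \<open>k\<close> extensional, as membership in
    \<open>objs\<close> demands.\<close>
  define k where "k = (\<lambda>j\<in>{1..d}. SOME n. n \<in> {1..l} \<and> M $$ (r (j - 1), j - 1) = \<xi> ^ n)"
  have k: "k j \<in> {1..l} \<and> M $$ (r (j - 1), j - 1) = \<xi> ^ k j" if j: "j \<in> {1..d}" for j
  proof -
    have *: "j - 1 < d" using j by auto
    have "\<exists>n. n \<in> {1..l} \<and> M $$ (r (j - 1), j - 1) = \<xi> ^ n"
      using root_of_unity_eq_power[OF l root[OF r(1)[OF *] * r(2)[OF *]]] by blast
    from someI_ex[OF this] show ?thesis
      using j by (simp add: k_def)
  qed
  have "k \<in> objs l d"
    unfolding objs_def using k by (intro PiE_I) (auto simp: k_def)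
  moreover have "M = monomial_mat d \<sigma> (\<lambda>j. \<xi> ^ k j)"
  proof (rule eq_matI)
    fix i j assume "i < dim_row (monomial_mat d \<sigma> (\<lambda>j. \<xi> ^ k j))"
      "j < dim_col (monomial_mat d \<sigma> (\<lambda>j. \<xi> ^ k j))"
    then have ij: "i < d" "j < d" by (simp_all add: monomial_mat_def)
    then show "M $$ (i, j) = monomial_mat d \<sigma> (\<lambda>j. \<xi> ^ k j) $$ (i, j)"
      using k[of "Suc j"] r_eq[of i j] by (auto simp: monomial_mat_def \<sigma>_def)
  qed (use dim in \<open>auto simp: monomial_mat_def\<close>)
  ultimately show thesis using perm that by blast
qed

text \<open>Conjugating \<open>s\<^sub>0\<close> with a transposition moves its entry \<open>\<xi>\<close> to any
  diagonal position.\<close>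

lemma monomial_mat_generated:
  assumes l: "l > 0" "\<xi> ^ l = 1"
    and perm: "\<And>\<sigma>. \<sigma> permutes {1..d} \<Longrightarrow> P (perm_matrix d \<sigma>)"
    and s0: "d \<ge> 1 \<Longrightarrow> P (s0_matrix d \<xi>)"
    and mult: "\<And>M N. M \<in> carrier (gen_sym_group l d) \<Longrightarrow> N \<in> carrier (gen_sym_group l d) \<Longrightarrow>
      P M \<Longrightarrow> P N \<Longrightarrow> P (M * N)"
    and \<sigma>: "\<sigma> permutes {1..d}"
  shows "P (monomial_mat d \<sigma> (\<lambda>j. \<xi> ^ k j))"
\<comment> \<open>Induction on the total exponent: one factor \<open>\<xi>\<close> in some column
  \<open>m\<close> is split off as a diagonal matrix on the right.\<close>
proof (induction "\<Sum>j\<in>{1..d}. k j" arbitrary: k)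
  case 0
  then have "monomial_mat d \<sigma> (\<lambda>j. \<xi> ^ k j) = perm_matrix d \<sigma>"
    unfolding perm_matrix_eq by (intro monomial_mat_cong) simp
  with perm[OF \<sigma>] show ?case by simp
next
  case (Suc n)
  \<comment> \<open>\<open>P\<close> is assumed to pass to products of group elements only, so every
    factor below has to be placed in the group.\<close>
  have mem: "monomial_mat d \<tau> a \<in> carrier (gen_sym_group l d)"
    if "\<tau> permutes {1..d}" "\<And>j. a j ^ l = 1" for \<tau> a
    using that l by (intro monomial_mat_in_gen_sym_group) auto
  have "(\<Sum>j\<in>{1..d}. k j) \<noteq> 0"
    unfolding Suc(2)[symmetric] by (rule Suc_not_Zero)
  then obtain m where m: "m \<in> {1..d}" "k m > 0"
    by (meson bot_nat_0.not_eq_extremum sum.neutral)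
  define k' where "k' = k(m := k m - 1)"
  define t where "t = transpose 1 m"
  have d: "d \<ge> 1" using m by simp
  have t: "t permutes {1..d}"
    unfolding t_def using m d by (intro permutes_swap_id) auto
  have "sum k {1..d} = k m + sum k ({1..d} - {m})" "sum k' {1..d} = k' m + sum k' ({1..d} - {m})"
    using m by (intro sum.remove; simp)+
  moreover have "sum k' ({1..d} - {m}) = sum k ({1..d} - {m})"
    by (intro sum.cong) (auto simp: k'_def)
  ultimately have "n = sum k' {1..d}"
    using Suc(2) m by (simp add: k'_def)
  then have IH: "P (monomial_mat d \<sigma> (\<lambda>j. \<xi> ^ k' j))" by (rule Suc(1))
  have one: "perm_matrix d t \<in> carrier (gen_sym_group l d)"
    unfolding perm_matrix_eq using t by (intro mem) auto
  have s0_mem: "s0_matrix d \<xi> \<in> carrier (gen_sym_group l d)"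
    unfolding s0_matrix_eq using l permutes_id by (intro mem) auto
  have eq1: "s0_matrix d \<xi> * perm_matrix d t = monomial_mat d t (\<lambda>j. if t j = 1 then \<xi> else 1)"
    unfolding s0_matrix_eq perm_matrix_eq using t permutes_id by (subst monomial_mat_mult) auto
  have P1: "P (monomial_mat d t (\<lambda>j. if t j = 1 then \<xi> else 1))"
    using mult[OF s0_mem one s0[OF d] perm[OF t]] unfolding eq1 .
  have eq2: "perm_matrix d t * monomial_mat d t (\<lambda>j. if t j = 1 then \<xi> else 1) =
      monomial_mat d id (\<lambda>j. if j = m then \<xi> else 1)"
  proof -
    have "t \<circ> t = id" by (simp add: t_def)
    moreover have "t j = 1 \<longleftrightarrow> j = m" for j by (auto simp: t_def transpose_def)
    ultimately show ?thesis
      unfolding perm_matrix_eq using t by (subst monomial_mat_mult) auto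
  qed
  have P2: "P (monomial_mat d id (\<lambda>j. if j = m then \<xi> else 1))"
    unfolding eq2[symmetric] using l t by (intro mult one perm P1 mem) auto
  have root: "(\<xi> ^ i) ^ l = 1" for i
    using l(2) by (metis mult.commute power_mult power_one)
  have eq3: "monomial_mat d \<sigma> (\<lambda>j. \<xi> ^ k' j) * monomial_mat d id (\<lambda>j. if j = m then \<xi> else 1) =
      monomial_mat d \<sigma> (\<lambda>j. \<xi> ^ k j)"
  proof -
    have "\<xi> ^ k' j * (if j = m then \<xi> else 1) = \<xi> ^ k j" for j
      using m(2) by (auto simp: k'_def simp flip: power_Suc2)
    then show ?thesis
      using \<sigma> permutes_id by (subst monomial_mat_mult) auto
  qed
  show ?case
    unfolding eq3[symmetric] using l \<sigma> permutes_id root by (intro mult IH P2 mem) auto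
qed

section \<open>The images of the group elements\<close>

text \<open>The entry used is that in row \<open>\<tau> j\<close> and column \<open>j\<close>,
  shifted to indices from 0.\<close>

definition weight :: "nat \<Rightarrow> complex mat \<Rightarrow> (nat \<Rightarrow> nat) \<Rightarrow> (nat \<Rightarrow> nat) \<Rightarrow> complex" where
  "weight d M \<tau> f = (\<Prod>j\<in>{1..d}. M $$ (\<tau> j - 1, j - 1) ^ f j)"

text \<open>Summing over all permutations avoids choosing \<open>\<sigma>\<close> and
  \<open>k\<close> for \<open>M\<close>: on a monomial matrix all weights vanish except at its own
  permutation. The target is the only \<open>g\<close> with
  \<open>g \<circ> \<tau> = f\<close>.\<close>

definition basis_image :: "nat \<Rightarrow> nat \<Rightarrow> complex mat \<Rightarrow> morphism \<Rightarrow>\<^sub>0 complex" where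
  "basis_image l d M =
     (\<Sum>\<tau>\<in>{\<tau>. \<tau> permutes {1..d}}. \<Sum>f\<in>objs l d.
        Poly_Mapping.single (Mor f \<tau> (f \<circ> perm_inv \<tau>)) (weight d M \<tau> f))"

lemma objs_comp:
  assumes "f \<in> objs l d" "\<sigma> permutes {1..d}"
  shows "f \<circ> \<sigma> \<in> objs l d"
  unfolding objs_def
proof (rule PiE_I)
  show "(f \<circ> \<sigma>) x \<in> {1..l}" if "x \<in> {1..d}" for x
    using PiE_mem[of f "{1..d}" "\<lambda>_. {1..l}" "\<sigma> x"] assms(1) permutes_in_image[OF assms(2)] that
    by (simp add: objs_def)
  show "(f \<circ> \<sigma>) x = undefined" if "x \<notin> {1..d}" for x
    using PiE_arb[of f "{1..d}" "\<lambda>_. {1..l}" x] assms(1) permutes_not_in[OF assms(2) that] that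
    by (simp add: objs_def)
qed

lemma comp_eq_iff_comp_inv:
  assumes "\<sigma> permutes S"
  shows "g \<circ> \<sigma> = f \<longleftrightarrow> g = f \<circ> perm_inv \<sigma>"
  using permutes_inv_o[OF assms] by (metis comp_assoc comp_id)

text \<open>A permutation is invertible, so source and permutation determine the target; morphisms
  are thus indexed by pairs, just like the group elements.\<close>

lemma mors_iff:
  "m \<in> mors l d \<longleftrightarrow> (\<exists>f\<in>objs l d. \<exists>\<sigma>. \<sigma> permutes {1..d} \<and> m = Mor f \<sigma> (f \<circ> perm_inv \<sigma>))"
proof
  assume "m \<in> mors l d"
  then obtain f \<sigma> g where "m = Mor f \<sigma> g" "f \<in> objs l d" "\<sigma> permutes {1..d}" "g \<circ> \<sigma> = f"
    unfolding mors_def by blast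
  then show "\<exists>f\<in>objs l d. \<exists>\<sigma>. \<sigma> permutes {1..d} \<and> m = Mor f \<sigma> (f \<circ> perm_inv \<sigma>)"
    using comp_eq_iff_comp_inv by blast
next
  assume "\<exists>f\<in>objs l d. \<exists>\<sigma>. \<sigma> permutes {1..d} \<and> m = Mor f \<sigma> (f \<circ> perm_inv \<sigma>)"
  then obtain f \<sigma> where *: "f \<in> objs l d" "\<sigma> permutes {1..d}" "m = Mor f \<sigma> (f \<circ> perm_inv \<sigma>)"
    by blast
  then have "f \<circ> perm_inv \<sigma> \<in> objs l d" "(f \<circ> perm_inv \<sigma>) \<circ> \<sigma> = f"
    using objs_comp permutes_inv comp_eq_iff_comp_inv by blast+
  with * show "m \<in> mors l d" unfolding mors_def by blast
qed

text \<open>The exponents \<open>f j\<close> are positive, so a single zero entry makes the weight vanish.\<close>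

lemma weight_monomial_mat:
  assumes "\<sigma> permutes {1..d}" "\<tau> permutes {1..d}" "f \<in> objs l d"
  shows "weight d (monomial_mat d \<sigma> a) \<tau> f = (if \<tau> = \<sigma> then \<Prod>j\<in>{1..d}. a j ^ f j else 0)"
proof -
  have entry: "monomial_mat d \<sigma> a $$ (\<tau> j - 1, j - 1) = (if \<tau> j = \<sigma> j then a j else 0)"
    if "j \<in> {1..d}" for j
  proof -
    have "\<tau> j \<in> {1..d}" using permutes_in_image[OF assms(2)] that by simp
    moreover from this that have "\<tau> j - 1 < d" "j - 1 < d" "Suc (\<tau> j - 1) = \<tau> j" "Suc (j - 1) = j"
      by auto
    ultimately show ?thesis by (simp add: monomial_mat_def)
  qed
  show ?thesis
  proof (cases "\<tau> = \<sigma>")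
    case True
    then show ?thesis
      unfolding weight_def if_P[OF True] by (intro prod.cong refl) (simp only: entry[unfolded True] refl if_True)
  next
    case False
    then obtain j where ne: "\<tau> j \<noteq> \<sigma> j" by blast
    then have j: "j \<in> {1..d}"
      using assms(1,2) by (metis permutes_not_in)
    then have "f j \<in> {1..l}"
      using assms(3) unfolding objs_def by (blast dest: PiE_mem)
    then have "monomial_mat d \<sigma> a $$ (\<tau> j - 1, j - 1) ^ f j = 0"
      unfolding entry[OF j] using ne by simp
    then have "weight d (monomial_mat d \<sigma> a) \<tau> f = 0"
      unfolding weight_def using j by (intro prod_zero) blast+
    with False show ?thesis by simp
  qed
qed

lemma basis_image_monomial_mat:
  assumes "\<sigma> permutes {1..d}"
  shows "basis_image l d (monomial_mat d \<sigma> a) =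
    (\<Sum>f\<in>objs l d. Poly_Mapping.single (Mor f \<sigma> (f \<circ> perm_inv \<sigma>)) (\<Prod>j\<in>{1..d}. a j ^ f j))"
proof -
  have "basis_image l d (monomial_mat d \<sigma> a) =
    (\<Sum>\<tau>\<in>{\<tau>. \<tau> permutes {1..d}}. if \<tau> = \<sigma> then
       \<Sum>f\<in>objs l d. Poly_Mapping.single (Mor f \<sigma> (f \<circ> perm_inv \<sigma>)) (\<Prod>j\<in>{1..d}. a j ^ f j) else 0)"
    unfolding basis_image_def
  proof (intro sum.cong refl)
    fix \<tau> assume "\<tau> \<in> {\<tau>. \<tau> permutes {1..d}}"
    then have \<tau>: "\<tau> permutes {1..d}" by simp
    show "(\<Sum>f\<in>objs l d. Poly_Mapping.single (Mor f \<tau> (f \<circ> perm_inv \<tau>)) (weight d (monomial_mat d \<sigma> a) \<tau> f)) =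
      (if \<tau> = \<sigma> then
       \<Sum>f\<in>objs l d. Poly_Mapping.single (Mor f \<sigma> (f \<circ> perm_inv \<sigma>)) (\<Prod>j\<in>{1..d}. a j ^ f j) else 0)"
      by (simp add: weight_monomial_mat[OF assms \<tau>])
  qed
  also have "\<dots> = (\<Sum>f\<in>objs l d. Poly_Mapping.single (Mor f \<sigma> (f \<circ> perm_inv \<sigma>)) (\<Prod>j\<in>{1..d}. a j ^ f j))"
    using assms by (simp add: finite_permutations)
  finally show ?thesis .
qed

lemma basis_image_power:
  assumes "\<sigma> permutes {1..d}"
  shows "basis_image l d (monomial_mat d \<sigma> (\<lambda>j. \<xi> ^ k j)) =
    (\<Sum>f\<in>objs l d. Poly_Mapping.single (Mor f \<sigma> (f \<circ> perm_inv \<sigma>)) (character d \<xi> k f))"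
  by (simp add: basis_image_monomial_mat[OF assms] character_def power_mult)

text \<open>A morphism \<open>\<sigma>\<close> from \<open>f\<close> can follow a morphism
  \<open>\<tau>\<close> from \<open>f'\<close> exactly when
  \<open>f = f' \<circ> perm_inv \<tau>\<close>. The double sum collapses to a sum over
  \<open>f'\<close>, and the coefficients match after reindexing by \<open>\<tau>\<close>.\<close>

lemma basis_image_mult:
  assumes \<sigma>: "\<sigma> permutes {1..d}" and \<tau>: "\<tau> permutes {1..d}"
  shows "basis_image l d (monomial_mat d \<sigma> a * monomial_mat d \<tau> b) =
    bilinear_ext mor_prod (basis_image l d (monomial_mat d \<sigma> a)) (basis_image l d (monomial_mat d \<tau> b))"
proof -
  define c where "c f = (\<Prod>j\<in>{1..d}. a j ^ f j)" for f
  define e where "e f = (\<Prod>j\<in>{1..d}. b j ^ f j)" for f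
  have st: "\<sigma> \<circ> \<tau> permutes {1..d}"
    by (rule permutes_compose[OF \<tau> \<sigma>])
  have inv_st: "f \<circ> perm_inv \<tau> \<circ> perm_inv \<sigma> = f \<circ> perm_inv (\<sigma> \<circ> \<tau>)" for f :: "nat \<Rightarrow> nat"
    using o_inv_distrib[OF permutes_bij[OF \<sigma>] permutes_bij[OF \<tau>]] by (simp add: comp_assoc)
  \<comment> \<open>Substituting \<open>\<tau> j\<close> for \<open>j\<close> in the first product
    cancels \<open>perm_inv \<tau>\<close> in the exponent and yields the column coefficients of the
    matrix product.\<close>
  have reindex: "c (f \<circ> perm_inv \<tau>) * e f = (\<Prod>j\<in>{1..d}. (a (\<tau> j) * b j) ^ f j)" for f
  proof -
    have "c (f \<circ> perm_inv \<tau>) = (\<Prod>j\<in>{1..d}. a (\<tau> j) ^ (f \<circ> perm_inv \<tau>) (\<tau> j))"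
      unfolding c_def by (subst prod.permute[OF \<tau>]) (simp add: comp_def)
    also have "\<dots> = (\<Prod>j\<in>{1..d}. a (\<tau> j) ^ f j)"
      by (simp add: permutes_inverses(2)[OF \<tau>])
    finally show ?thesis
      by (simp add: e_def power_mult_distrib prod.distrib)
  qed
  have "bilinear_ext mor_prod (basis_image l d (monomial_mat d \<sigma> a)) (basis_image l d (monomial_mat d \<tau> b)) =
    (\<Sum>f\<in>objs l d. \<Sum>f'\<in>objs l d.
       scale (c f * e f') (mor_prod (Mor f \<sigma> (f \<circ> perm_inv \<sigma>)) (Mor f' \<tau> (f' \<circ> perm_inv \<tau>))))"
    by (simp only: basis_image_monomial_mat[OF \<sigma>] basis_image_monomial_mat[OF \<tau>]
        bilinear_ext_sum_single c_def e_def)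
  also have "\<dots> = (\<Sum>f'\<in>objs l d. \<Sum>f\<in>objs l d.
       if f = f' \<circ> perm_inv \<tau>
       then Poly_Mapping.single (Mor f' (\<sigma> \<circ> \<tau>) (f \<circ> perm_inv \<sigma>)) (c f * e f') else 0)"
    by (subst sum.swap, intro sum.cong refl) (simp add: mor_prod_def)
  \<comment> \<open>The selected source \<open>f' \<circ> perm_inv \<tau>\<close> is again an
    object, so its term does occur in the inner sum.\<close>
  also have "\<dots> = (\<Sum>f'\<in>objs l d. Poly_Mapping.single
      (Mor f' (\<sigma> \<circ> \<tau>) (f' \<circ> perm_inv \<tau> \<circ> perm_inv \<sigma>)) (c (f' \<circ> perm_inv \<tau>) * e f'))"
    by (intro sum.cong refl) (simp add: objs_comp[OF _ permutes_inv[OF \<tau>]])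
  also have "\<dots> = basis_image l d (monomial_mat d \<sigma> a * monomial_mat d \<tau> b)"
    by (simp only: monomial_mat_mult[OF \<sigma> \<tau>] basis_image_monomial_mat[OF st] inv_st reindex)
  finally show ?thesis ..
qed

lemma basis_image_one: "basis_image l d (1\<^sub>m d) = (\<Sum>f\<in>objs l d. id_mor f)"
  unfolding one_mat_eq basis_image_monomial_mat[OF permutes_id]
  by (simp add: id_mor_def)

text \<open>For each \<open>f\<close> the inner sum over \<open>g\<close> has exactly one non-zero
  term, at \<open>g = f \<circ> perm_inv \<sigma>\<close>.\<close>

lemma basis_image_perm_matrix:
  assumes "\<sigma> permutes {1..d}"
  shows "basis_image l d (perm_matrix d \<sigma>) = (\<Sum>f\<in>objs l d. \<Sum>g\<in>objs l d. perm_mor \<sigma> f g)"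
  unfolding perm_matrix_eq basis_image_monomial_mat[OF assms]
proof (intro sum.cong refl)
  fix f assume f: "f \<in> objs l d"
  have "(\<Sum>g\<in>objs l d. perm_mor \<sigma> f g) =
      (\<Sum>g\<in>objs l d. if g = f \<circ> perm_inv \<sigma> then Poly_Mapping.single (Mor f \<sigma> g) 1 else 0)"
    by (simp add: perm_mor_def comp_eq_iff_comp_inv[OF assms])
  also have "\<dots> = Poly_Mapping.single (Mor f \<sigma> (f \<circ> perm_inv \<sigma>)) 1"
    using objs_comp[OF f permutes_inv[OF assms]] by simp
  finally show "Poly_Mapping.single (Mor f \<sigma> (f \<circ> perm_inv \<sigma>)) (\<Prod>j\<in>{1..d}. 1 ^ f j) =
      (\<Sum>g\<in>objs l d. perm_mor \<sigma> f g)"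
    by simp
qed

lemma basis_image_s0_matrix:
  assumes "d \<ge> 1"
  shows "basis_image l d (s0_matrix d \<xi>) = (\<Sum>f\<in>objs l d. scale (\<xi> ^ f 1) (id_mor f))"
proof -
  \<comment> \<open>Only the factor at \<open>j = 1\<close> differs from 1, and
    \<open>d \<ge> 1\<close> puts 1 in the index range.\<close>
  have "(\<Prod>j\<in>{1..d}. (if j = 1 then \<xi> else 1) ^ f j) = \<xi> ^ f 1" for f :: "nat \<Rightarrow> nat"
  proof -
    have "(\<Prod>j\<in>{1..d}. (if j = 1 then \<xi> else 1) ^ f j) = (\<Prod>j\<in>{1..d}. if j = 1 then \<xi> ^ f j else 1)"
      by (intro prod.cong) auto
    with assms show ?thesis by simp
  qed
  then show ?thesis
    unfolding s0_matrix_eq basis_image_monomial_mat[OF permutes_id]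
    by (simp add: id_mor_def)
qed

lemma keys_basis_image: "Poly_Mapping.keys (basis_image l d M) \<subseteq> mors l d"
  unfolding basis_image_def
proof (intro order.trans[OF keys_sum] UN_least)
  fix \<tau> f assume "\<tau> \<in> {\<tau>. \<tau> permutes {1..d}}" "f \<in> objs l d"
  then have "Mor f \<tau> (f \<circ> perm_inv \<tau>) \<in> mors l d"
    by (auto simp: mors_iff)
  then show "Poly_Mapping.keys (Poly_Mapping.single (Mor f \<tau> (f \<circ> perm_inv \<tau>)) (weight d M \<tau> f)) \<subseteq> mors l d"
    by simp
qed

section \<open>Fourier inversion\<close>

text \<open>The inverse Fourier transform for a fixed permutation: coefficients are reciprocals of
  character values at the source, normalised by the order \<open>l ^ d\<close> of (Z/l)^d.\<close>

definition fourier_inverse :: "nat \<Rightarrow> nat \<Rightarrow> complex \<Rightarrow> morphism \<Rightarrow> complex mat \<Rightarrow>\<^sub>0 complex" where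
  "fourier_inverse l d \<xi> m =
     (\<Sum>k\<in>objs l d. Poly_Mapping.single (monomial_mat d (bij_of m) (\<lambda>j. \<xi> ^ k j))
        (1 / (of_nat l ^ d * character d \<xi> k (src m))))"

lemma sum_single_same:
  "(\<Sum>i\<in>S. Poly_Mapping.single a (c i)) = Poly_Mapping.single a (\<Sum>i\<in>S. c i)"
  by (induction S rule: infinite_finite_induct) (simp_all add: single_add)

text \<open>Exchanging the sums leaves, for each \<open>k'\<close>, a sum over objects
  \<open>f\<close>. By symmetry of the pairing, orthogonality applies with \<open>k\<close> and
  \<open>k'\<close> as the two compared objects.\<close>

lemma fourier_inverse_basis_image:
  assumes "l > 0" "primitive_root_of_unity l \<xi>" "\<sigma> permutes {1..d}" "k \<in> objs l d"
  shows "linext (fourier_inverse l d \<xi>) (basis_image l d (monomial_mat d \<sigma> (\<lambda>j. \<xi> ^ k j))) =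
    Poly_Mapping.single (monomial_mat d \<sigma> (\<lambda>j. \<xi> ^ k j)) 1"
proof -
  let ?M = "\<lambda>k. monomial_mat d \<sigma> (\<lambda>j. \<xi> ^ k j)"
  have "linext (fourier_inverse l d \<xi>) (basis_image l d (?M k)) =
      (\<Sum>f\<in>objs l d. \<Sum>k'\<in>objs l d. Poly_Mapping.single (?M k')
         (character d \<xi> f k / character d \<xi> f k' / of_nat l ^ d))"
    unfolding basis_image_power[OF assms(3)]
    by (simp add: linext_sum fourier_inverse_def scale.scale_sum_right mult.commute character_commute)
  also have "\<dots> = (\<Sum>k'\<in>objs l d. Poly_Mapping.single (?M k')
         ((\<Sum>f\<in>objs l d. character d \<xi> f k / character d \<xi> f k') / of_nat l ^ d))"
    by (subst sum.swap) (simp add: sum_single_same sum_divide_distrib)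
  also have "\<dots> = (\<Sum>k'\<in>objs l d. if k' = k then Poly_Mapping.single (?M k') 1 else 0)"
    using assms(1) by (intro sum.cong refl) (simp add: character_orthogonality[OF assms(1,2,4)])
  also have "\<dots> = Poly_Mapping.single (?M k) 1"
    using assms(4) by simp
  finally show ?thesis .
qed

text \<open>In this composite the sum over exponents \<open>k\<close> is the inner one, and
  orthogonality singles out the source of \<open>m\<close>.\<close>

lemma basis_image_fourier_inverse:
  assumes "l > 0" "primitive_root_of_unity l \<xi>" "m \<in> mors l d"
  shows "linext (basis_image l d) (fourier_inverse l d \<xi> m) = Poly_Mapping.single m 1"
proof -
  obtain f \<sigma> where f: "f \<in> objs l d" and \<sigma>: "\<sigma> permutes {1..d}" and m: "m = Mor f \<sigma> (f \<circ> perm_inv \<sigma>)"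
    using assms(3) unfolding mors_iff by blast
  let ?m = "\<lambda>f. Mor f \<sigma> (f \<circ> perm_inv \<sigma>)"
  have "linext (basis_image l d) (fourier_inverse l d \<xi> m) =
      (\<Sum>k\<in>objs l d. \<Sum>f'\<in>objs l d. Poly_Mapping.single (?m f')
         (character d \<xi> k f' / character d \<xi> k f / of_nat l ^ d))"
    unfolding m
    by (simp add: linext_sum fourier_inverse_def basis_image_power[OF \<sigma>] scale.scale_sum_right mult.commute)
  also have "\<dots> = (\<Sum>f'\<in>objs l d. Poly_Mapping.single (?m f')
         ((\<Sum>k\<in>objs l d. character d \<xi> k f' / character d \<xi> k f) / of_nat l ^ d))"
    by (subst sum.swap) (simp add: sum_single_same sum_divide_distrib)
  also have "\<dots> = (\<Sum>f'\<in>objs l d. if f' = f then Poly_Mapping.single (?m f') 1 else 0)"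
    using assms(1) by (intro sum.cong refl) (simp add: character_orthogonality[OF assms(1,2) _ f])
  also have "\<dots> = Poly_Mapping.single m 1"
    using f by (simp add: m)
  finally show ?thesis .
qed

lemma keys_fourier_inverse:
  assumes "l > 0" "primitive_root_of_unity l \<xi>" "m \<in> mors l d"
  shows "Poly_Mapping.keys (fourier_inverse l d \<xi> m) \<subseteq> carrier (gen_sym_group l d)"
  unfolding fourier_inverse_def
proof (intro order.trans[OF keys_sum] UN_least)
  fix k :: "nat \<Rightarrow> nat"
  have \<sigma>: "bij_of m permutes {1..d}"
    using assms(3) by (auto simp: mors_iff)
  have "\<xi> ^ l = 1"
    using assms(2) unfolding primitive_root_of_unity_def by blast
  then have "(\<xi> ^ n) ^ l = 1" for n
    by (metis mult.commute power_mult power_one)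
  then have "monomial_mat d (bij_of m) (\<lambda>j. \<xi> ^ k j) \<in> carrier (gen_sym_group l d)"
    by (intro monomial_mat_in_gen_sym_group[OF assms(1) \<sigma>])
  then show "Poly_Mapping.keys (Poly_Mapping.single (monomial_mat d (bij_of m) (\<lambda>j. \<xi> ^ k j))
      (1 / (of_nat l ^ d * character d \<xi> k (src m)))) \<subseteq> carrier (gen_sym_group l d)"
    by simp
qed

lemma group_algebra_gen_sym_group:
  "group_algebra (gen_sym_group l d) =
   based_algebra (carrier (gen_sym_group l d)) (\<lambda>M N. Poly_Mapping.single (M * N) 1)
     (Poly_Mapping.single (1\<^sub>m d) 1)"
  unfolding group_algebra_def gen_sym_group_def monoid.simps ..

text \<open>Well-definedness by values on generators is expressed as existence together with
  uniqueness among algebra homomorphisms. Uniqueness is asserted on the carrier, outside which a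
  homomorphism is unconstrained.\<close>

theorem theorem4:
  fixes l d :: nat and \<xi> :: complex
  assumes "l > 0"
    and "primitive_root_of_unity l \<xi>"
  shows "\<exists>\<Phi> \<in> calg_iso (group_algebra (gen_sym_group l d)) (groupoid_algebra l d).
           generator_values l d \<xi> \<Phi> \<and>
           (\<forall>\<Psi> \<in> calg_hom (group_algebra (gen_sym_group l d)) (groupoid_algebra l d).
              generator_values l d \<xi> \<Psi> \<longrightarrow>
              (\<forall>x \<in> carrier (group_algebra (gen_sym_group l d)). \<Psi> x = \<Phi> x))"
proof -
  let ?G = "carrier (gen_sym_group l d)"
  let ?\<Phi> = "linext (basis_image l d)"
  have \<xi>: "\<xi> ^ l = 1"
    using assms(2) unfolding primitive_root_of_unity_def by blast
  have basis_mult: "basis_image l d (M * N) =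
      bilinear_ext mor_prod (basis_image l d M) (basis_image l d N)" if "M \<in> ?G" "N \<in> ?G" for M N
    using basis_image_mult gen_sym_group_obtain_monomial[OF assms that(1)]
      gen_sym_group_obtain_monomial[OF assms that(2)] by metis
  have "?\<Phi> \<in> calg_hom (group_algebra (gen_sym_group l d)) (groupoid_algebra l d)"
    unfolding group_algebra_gen_sym_group groupoid_algebra_def
    by (rule linext_calg_hom) (simp_all add: keys_basis_image basis_mult basis_image_one)
  then have iso: "?\<Phi> \<in> calg_iso (group_algebra (gen_sym_group l d)) (groupoid_algebra l d)"
    unfolding group_algebra_gen_sym_group groupoid_algebra_def
  proof (rule linext_calg_iso)
    show "linext (fourier_inverse l d \<xi>) (basis_image l d M) = Poly_Mapping.single M 1" if "M \<in> ?G" for M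
      using fourier_inverse_basis_image[OF assms] gen_sym_group_obtain_monomial[OF assms that] by metis
  qed (simp_all add: keys_fourier_inverse basis_image_fourier_inverse assms)
  have gens: "generator_values l d \<xi> ?\<Phi>"
    unfolding generator_values_def by (simp add: basis_image_perm_matrix basis_image_s0_matrix)
  have "\<Psi> x = ?\<Phi> x"
    if hom: "\<Psi> \<in> calg_hom (group_algebra (gen_sym_group l d)) (groupoid_algebra l d)"
      and gen: "generator_values l d \<xi> \<Psi>"
      and x: "x \<in> carrier (group_algebra (gen_sym_group l d))" for \<Psi> x
  proof -
    note hom' = hom[unfolded group_algebra_gen_sym_group groupoid_algebra_def]
    have x': "Poly_Mapping.keys x \<subseteq> ?G"
      using x unfolding group_algebra_gen_sym_group carrier_based_algebra by simp
    \<comment> \<open>The two homomorphisms agree at the basis element \<open>M\<close>. This holds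
      at the generators and passes to products, hence holds on the whole group.\<close>
    define P where "P M \<longleftrightarrow> \<Psi> (Poly_Mapping.single M 1) = basis_image l d M" for M
    have "P (monomial_mat d \<sigma> (\<lambda>j. \<xi> ^ k j))" if "\<sigma> permutes {1..d}" for \<sigma> k
    proof (rule monomial_mat_generated[OF assms(1) \<xi> _ _ _ that])
      show "P (perm_matrix d \<tau>)" if "\<tau> permutes {1..d}" for \<tau>
        using gen that by (simp add: P_def generator_values_def basis_image_perm_matrix)
      show "P (s0_matrix d \<xi>)" if "d \<ge> 1"
        using gen that by (simp add: P_def generator_values_def basis_image_s0_matrix)
      show "P (M * N)" if "M \<in> ?G" "N \<in> ?G" "P M" "P N" for M N
      proof -
        have "\<Psi> (bilinear_ext (\<lambda>M N. Poly_Mapping.single (M * N) 1)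
            (Poly_Mapping.single M 1) (Poly_Mapping.single N 1)) =
          bilinear_ext mor_prod (\<Psi> (Poly_Mapping.single M 1)) (\<Psi> (Poly_Mapping.single N 1))"
          by (rule hom'[unfolded calg_hom_based_algebra_iff, THEN conjunct2, THEN conjunct1,
                rule_format, THEN conjunct1]) (use that(1,2) in simp)
        then show ?thesis
          using that(3,4) by (simp add: P_def basis_mult[OF that(1,2)])
      qed
    qed
    then have "P M" if "M \<in> ?G" for M
      using gen_sym_group_obtain_monomial[OF assms that] by metis
    \<comment> \<open>Agreement on group elements extends linearly, because \<open>\<Psi>\<close> is
      on the carrier the linear extension of its values at basis elements.\<close>
    then have "linext (\<lambda>M. \<Psi> (Poly_Mapping.single M 1)) x = ?\<Phi> x"
      using x' by (intro linext_cong) (auto simp: P_def)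
    with calg_hom_eq_linext[OF hom' x'] show ?thesis by simp
  qed
  with iso gens show ?thesis by blast
qed

end
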